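(* Let $X$ be a complex Banach space, let $A:\operatorname{dom}(A)\subseteq X\to X$ and $B:\operatorname{dom}(B)\subseteq X\to X$ be closed linear operators with $\rho(B)\neq\emptyset$, and let $Y$ be a Banach space continuously embedded in $X$ such that $\operatorname{dom}(A)\subseteq\operatorname{dom}(B^2)\cap Y$, $B(\operatorname{dom}(A))\subseteq Y\subseteq\operatorname{dom}(B)$, and the operator $G=\begin{bmatrix}-B & I \\ A+B^2 & -B\end{bmatrix}$ with domain $\operatorname{dom}(A)\times Y$ generates a $C_0$-group $\{\mathcal T(t)\}_{t\in\mathbb R}$ on $Y\times X$. Then for all $t,s\in\mathbb R$: (i) $S_{A,B}(t+s)=C_{A,B}(t)S_{A,B}(s)+S_{A,B}(t)S_{A,B}'(s)$ (on $X$); (ii) $C_{A,B}(t+s)|_Y=C_{A,B}(t)C_{A,B}(s)|_Y+S_{A,B}(t)C_{A,B}'(s)|_Y$.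
   Context: Write $\mathcal T(t)=\begin{bmatrix}T_{11}(t) & T_{12}(t) \\ T_{21}(t) & T_{22}(t)\end{bmatrix}$ in block form with respect to $Y\times X$. The generalized cosine and sine families $C_{A,B}(t)\in\mathcal B(\operatorname{dom}(B),X)$ (graph norm on $\operatorname{dom}(B)$) and $S_{A,B}(t)\in\mathcal B(X)$ are given by $C_{A,B}(t)x=T_{22}(t)x-BT_{12}(t)x+2T_{12}(t)Bx$ for $x\in\operatorname{dom}(B)$ and $S_{A,B}(t)x=T_{12}(t)x$ for $x\in X$. It is known that $S_{A,B}(t)X\subseteq Y$, $C_{A,B}(t)Y\subseteq Y$, $S_{A,B}(\cdot)x\in\mathcal C^1(\mathbb R,X)$ for $x\in X$ and $C_{A,B}(\cdot)y\in\mathcal C^1(\mathbb R,X)$ for $y\in Y$; $S_{A,B}'(t)x:=(S_{A,B}(t)x)'$ and $C_{A,B}'(t)y:=(C_{A,B}(t)y)'$ denote the (strong) derivatives in $X$. *)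

theory Defs
  imports "HOL-Analysis.Analysis"
begin

section \<open>Complex Banach spaces\<close>

text \<open>The library has only real normed spaces. A complex one is a real one with a compatible
  complex scalar multiplication, so limits, derivatives and \<^const>\<open>bounded_linear\<close> keep their
  library meaning.\<close>

class scaleC =
  fixes scaleC :: "complex \<Rightarrow> 'a \<Rightarrow> 'a" (infixr "*\<^sub>C" 75)

class complex_vector = real_vector + scaleC +
  assumes scaleC_add_right: "a *\<^sub>C (x + y) = a *\<^sub>C x + a *\<^sub>C y"
    and scaleC_add_left: "(a + b) *\<^sub>C x = a *\<^sub>C x + b *\<^sub>C x"
    and scaleC_scaleC: "a *\<^sub>C (b *\<^sub>C x) = (a * b) *\<^sub>C x"
    and scaleC_of_real: "complex_of_real r *\<^sub>C x = r *\<^sub>R x"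

class complex_normed_vector = real_normed_vector + complex_vector +
  assumes norm_scaleC: "norm (a *\<^sub>C x) = cmod a * norm x"

class complex_banach = complex_normed_vector + complete_space

instance complex_banach \<subseteq> banach ..

instantiation complex :: complex_banach
begin
definition scaleC_complex :: "complex \<Rightarrow> complex \<Rightarrow> complex" where
  "scaleC_complex a x = a * x"
instance
  by standard (simp_all add: scaleC_complex_def algebra_simps scaleR_conv_of_real norm_mult)
end

instantiation prod :: (complex_vector, complex_vector) complex_vector
begin
definition scaleC_prod :: "complex \<Rightarrow> 'a \<times> 'b \<Rightarrow> 'a \<times> 'b" where
  "scaleC_prod a p = (a *\<^sub>C fst p, a *\<^sub>C snd p)"
instance
  by standard
    (simp_all add: scaleC_prod_def scaleC_add_right scaleC_add_left scaleC_scaleC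
      scaleC_of_real prod_eq_iff)
end

text \<open>The library norm on a product is the Euclidean one.\<close>

instance prod :: (complex_normed_vector, complex_normed_vector) complex_normed_vector
proof
  fix a :: complex and x :: "'a \<times> 'b"
  have "(cmod a * norm (fst x))\<^sup>2 + (cmod a * norm (snd x))\<^sup>2
      = (cmod a)\<^sup>2 * ((norm (fst x))\<^sup>2 + (norm (snd x))\<^sup>2)"
    by (simp add: power_mult_distrib distrib_left)
  then show "norm (a *\<^sub>C x) = cmod a * norm x"
    by (simp add: scaleC_prod_def norm_prod_def norm_scaleC real_sqrt_mult)
qed

instance prod :: (complex_banach, complex_banach) complex_banach ..

definition bounded_clinear :: "('a::complex_normed_vector \<Rightarrow> 'b::complex_normed_vector) \<Rightarrow> bool"
  where "bounded_clinear f \<longleftrightarrow> bounded_linear f \<and> (\<forall>c x. f (c *\<^sub>C x) = c *\<^sub>C f x)"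

definition continuous_embedding ::
  "('y::complex_normed_vector \<Rightarrow> 'x::complex_normed_vector) \<Rightarrow> bool"
  where "continuous_embedding \<iota> \<longleftrightarrow> bounded_clinear \<iota> \<and> inj \<iota>"


section \<open>Unbounded operators\<close>

text \<open>An unbounded operator is given by a domain and a total function whose values outside the
  domain are irrelevant.\<close>

definition linear_operator :: "'a::complex_vector set \<Rightarrow> ('a \<Rightarrow> 'a) \<Rightarrow> bool"
  where "linear_operator D A \<longleftrightarrow>
    0 \<in> D \<and>
    (\<forall>x\<in>D. \<forall>y\<in>D. x + y \<in> D \<and> A (x + y) = A x + A y) \<and>
    (\<forall>c. \<forall>x\<in>D. c *\<^sub>C x \<in> D \<and> A (c *\<^sub>C x) = c *\<^sub>C A x)"

definition closed_linear_operator :: "'a::complex_normed_vector set \<Rightarrow> ('a \<Rightarrow> 'a) \<Rightarrow> bool"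
  where "closed_linear_operator D A \<longleftrightarrow> linear_operator D A \<and> closed {(x, A x) | x. x \<in> D}"

definition resolvent_set ::
  "'a::complex_normed_vector set \<Rightarrow> ('a \<Rightarrow> 'a) \<Rightarrow> complex set"
  where "resolvent_set D A = {l. \<exists>R. bounded_clinear R \<and>
    (\<forall>x. R x \<in> D \<and> l *\<^sub>C R x - A (R x) = x) \<and>
    (\<forall>x\<in>D. R (l *\<^sub>C x - A x) = x)}"


section \<open>Groups of operators\<close>

definition c0_group :: "(real \<Rightarrow> 'a::complex_normed_vector \<Rightarrow> 'a) \<Rightarrow> bool"
  where "c0_group T \<longleftrightarrow>
    (\<forall>t. bounded_clinear (T t)) \<and>
    T 0 = id \<and>
    (\<forall>t s. T (t + s) = T t \<circ> T s) \<and>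
    (\<forall>x. continuous_on UNIV (\<lambda>t. T t x))"

definition generates_c0_group ::
  "'a::complex_normed_vector set \<Rightarrow> ('a \<Rightarrow> 'a) \<Rightarrow> (real \<Rightarrow> 'a \<Rightarrow> 'a) \<Rightarrow> bool"
  where "generates_c0_group D G T \<longleftrightarrow>
    c0_group T \<and>
    D = {x. \<exists>l. ((\<lambda>h. (T h x - x) /\<^sub>R h) \<longlongrightarrow> l) (at 0)} \<and>
    (\<forall>x\<in>D. ((\<lambda>h. (T h x - x) /\<^sub>R h) \<longlongrightarrow> G x) (at 0))"


section \<open>The operator matrix and the generalized cosine and sine families\<close>

text \<open>The space \<open>Y\<close> is a type with an embedding \<open>\<iota>\<close> into \<open>X\<close>; as a subset of \<open>X\<close> it is
  \<^term>\<open>range \<iota>\<close>. The first component below is the element of \<open>Y\<close> corresponding to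
  \<open>- B y + x\<close>, which lies in \<open>Y\<close> for \<open>(y, x)\<close> in \<open>dom A \<times> Y\<close> because \<open>B (dom A) \<subseteq> Y\<close>.\<close>

definition matrix_op ::
  "('y \<Rightarrow> 'x) \<Rightarrow> ('x \<Rightarrow> 'x) \<Rightarrow> ('x \<Rightarrow> 'x) \<Rightarrow> 'y \<times> 'x \<Rightarrow> 'y \<times> 'x::complex_vector"
  where "matrix_op \<iota> A B = (\<lambda>(y, x).
    (inv \<iota> (- B (\<iota> y) + x), (A (\<iota> y) + B (B (\<iota> y))) - B x))"

definition matrix_dom :: "('y \<Rightarrow> 'x) \<Rightarrow> 'x set \<Rightarrow> ('y \<times> 'x) set"
  where "matrix_dom \<iota> DA = {y. \<iota> y \<in> DA} \<times> range \<iota>"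

definition block12 :: "(real \<Rightarrow> 'y::zero \<times> 'x \<Rightarrow> 'y \<times> 'x) \<Rightarrow> real \<Rightarrow> 'x \<Rightarrow> 'y"
  where "block12 T t x = fst (T t (0, x))"

definition block22 :: "(real \<Rightarrow> 'y::zero \<times> 'x \<Rightarrow> 'y \<times> 'x) \<Rightarrow> real \<Rightarrow> 'x \<Rightarrow> 'x"
  where "block22 T t x = snd (T t (0, x))"

text \<open>The cosine family is meaningful on \<open>dom B\<close> only.\<close>

definition cosine_family ::
  "('y::zero \<Rightarrow> 'x::complex_vector) \<Rightarrow> ('x \<Rightarrow> 'x) \<Rightarrow> (real \<Rightarrow> 'y \<times> 'x \<Rightarrow> 'y \<times> 'x)
    \<Rightarrow> real \<Rightarrow> 'x \<Rightarrow> 'x"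
  where "cosine_family \<iota> B T t x =
    block22 T t x - B (\<iota> (block12 T t x)) + 2 *\<^sub>R \<iota> (block12 T t (B x))"

definition sine_family ::
  "('y::zero \<Rightarrow> 'x) \<Rightarrow> (real \<Rightarrow> 'y \<times> 'x \<Rightarrow> 'y \<times> 'x) \<Rightarrow> real \<Rightarrow> 'x \<Rightarrow> 'x"
  where "sine_family \<iota> T t x = \<iota> (block12 T t x)"

definition strong_deriv :: "(real \<Rightarrow> 'x \<Rightarrow> 'x::real_normed_vector) \<Rightarrow> real \<Rightarrow> 'x \<Rightarrow> 'x"
  where "strong_deriv F t x = vector_derivative (\<lambda>r. F r x) (at t)"

end

theory Submission
  imports Defs
begin

text \<open>By the closed graph theorem \<open>B\<close> is bounded from \<open>Y\<close> to \<open>X\<close>, so for every \<open>z\<close> the first component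
  \<open>u\<close> of \<open>T(\<cdot>)z = (u, v)\<close> is differentiable in \<open>X\<close> with \<open>u' = v - B u\<close>. Moreover
  \<open>C(t) y\<close> is the first component of \<open>T(t)(y, B y)\<close> for \<open>y\<close> in \<open>Y\<close>. Since
  \<open>T(s)z = (u(s), B u(s)) + (0, u'(s))\<close>, applying \<open>T(t)\<close> gives \<open>u(t + s) = C(t) u(s) + S(t) u'(s)\<close>.
  The initial values \<open>z = (0, x)\<close> and \<open>z = (y, B y)\<close> are the two functional equations.\<close>

section \<open>The closed graph theorem\<close>

text \<open>By Baire, the closure of some sublevel set of \<open>norm (L x)\<close> contains a ball.
  Any direction \<open>u\<close> is a rescaled difference of two points of that ball, and
  approximating both points inside the sublevel set approximates \<open>u\<close> with controlled
  image.\<close>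

lemma linear_uniformly_dense_sublevel:
  fixes L :: "'a::banach \<Rightarrow> 'b::real_normed_vector"
  assumes "linear L"
  obtains M where "M > 0"
    "\<And>u e. e > 0 \<Longrightarrow> \<exists>w. norm (u - w) < e \<and> norm (L w) \<le> M * norm u"
proof -
  interpret L: linear L by fact
  define F where "F n = closure {x. norm (L x) \<le> real n}" for n
  have "\<exists>n. interior (F n) \<noteq> {}"
  proof (rule ccontr)
    assume "\<not> ?thesis"
    then have "closedin euclidean S \<and> euclidean interior_of S = {}" if "S \<in> range F" for S
      using that by (auto simp: F_def simp flip: closed_closedin)
    then have "euclidean interior_of \<Union>(range F) = {}"
      by (intro Baire_category_alt disjI1 completely_metrizable_space_euclidean) auto
    moreover have "\<Union>(range F) = UNIV"
    proof -
      have "x \<in> F (nat \<lceil>norm (L x)\<rceil>)" for x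
        unfolding F_def by (rule subsetD[OF closure_subset]) (simp add: real_nat_ceiling_ge)
      then show ?thesis by blast
    qed
    ultimately show False by simp
  qed
  then obtain n x0 where "x0 \<in> interior (F n)" by blast
  then obtain r where r: "r > 0" "cball x0 r \<subseteq> F n"
    unfolding mem_interior_cball by blast
  \<comment> \<open>Two points of the sublevel set have images at most \<open>2 * n\<close> apart,
    and rescaling divides by \<open>r / norm u\<close>. The summand 1 keeps \<open>M\<close>
    positive when \<open>n = 0\<close>.\<close>
  define M where "M = 2 * (real n + 1) / r"
  have "M > 0" using r by (simp add: M_def)
  have approx: "\<exists>w. norm (u - w) < e \<and> norm (L w) \<le> M * norm u" if "e > 0" for u e
  proof (cases "u = 0")
    case True
    then show ?thesis using that by (intro exI[of _ 0]) simp
  next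
    case False
    \<comment> \<open>This factor gives \<open>c *\<^sub>R u\<close> length \<open>r\<close>, so
      \<open>x0 + c *\<^sub>R u\<close> stays in the ball. Tolerance \<open>c * e / 2\<close> at
      both points becomes \<open>e\<close> after division by \<open>c\<close>.\<close>
    define c where "c = r / norm u"
    have c: "c > 0" using False r by (simp add: c_def)
    have "x0 \<in> F n" "x0 + c *\<^sub>R u \<in> F n"
      using r False by (auto simp: c_def dist_norm subset_eq)
    moreover have "c * e / 2 > 0" using c that by simp
    ultimately obtain p q where p: "norm (L p) \<le> n" "dist p x0 < c * e / 2"
      and q: "norm (L q) \<le> n" "dist q (x0 + c *\<^sub>R u) < c * e / 2"
      unfolding F_def closure_approachable by blast
    define w where "w = (q - p) /\<^sub>R c"
    have "c *\<^sub>R (u - w) = (p - x0) - (q - (x0 + c *\<^sub>R u))"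
      using c by (simp add: w_def algebra_simps)
    then have "c * norm (u - w) = norm ((p - x0) - (q - (x0 + c *\<^sub>R u)))"
      using c by (metis abs_of_pos norm_scaleR)
    also have "\<dots> < c * e"
      using p(2) q(2) norm_triangle_ineq4[of "p - x0" "q - (x0 + c *\<^sub>R u)"]
      by (simp add: dist_norm)
    finally have 1: "norm (u - w) < e" using c by simp
    have "norm (L w) = norm (L q - L p) / c"
      using c by (simp add: w_def L.scale L.diff divide_inverse mult.commute)
    also have "\<dots> \<le> (2 * (real n + 1)) / c"
      using p(1) q(1) norm_triangle_ineq4[of "L q" "L p"] c
      by (intro divide_right_mono) auto
    also have "\<dots> = M * norm u" by (simp add: M_def c_def)
    finally show ?thesis using 1 by blast
  qed
  show thesis by (rule that[OF \<open>M > 0\<close> approx])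
qed

text \<open>Successive approximation: subtracting approximants of \<open>u\<close> leaves residuals
  that halve in size, so their images form an absolutely convergent series. Closedness of the graph
  identifies its sum with \<open>L u\<close>.\<close>

theorem closed_graph_bounded_linear:
  fixes L :: "'a::banach \<Rightarrow> 'b::banach"
  assumes "linear L" and closed: "closed (range (\<lambda>x. (x, L x)))"
  shows "bounded_linear L"
proof -
  interpret L: linear L by fact
  obtain M where M: "M > 0"
    and dense: "\<And>u e. e > 0 \<Longrightarrow> \<exists>w. norm (u - w) < e \<and> norm (L w) \<le> M * norm u"
    using linear_uniformly_dense_sublevel[OF assms(1)] by metis
  have "norm (L u) \<le> 2 * M * norm u" for u
  proof (cases "u = 0")
    case True
    then show ?thesis by simp
  next
    case False
    define e where "e n = norm u / 2 ^ n" for n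
    have e: "e n > 0" for n using False by (simp add: e_def)
    define step where "step n v = (SOME w. norm (v - w) < e (Suc n) \<and> norm (L w) \<le> M * norm v)"
      for n v
    have step: "norm (v - step n v) < e (Suc n)" "norm (L (step n v)) \<le> M * norm v" for n v
      using someI_ex[OF dense[OF e]] unfolding step_def by blast+
    define R where "R = rec_nat u (\<lambda>n v. v - step n v)"
    have R0: "R 0 = u" and RS: "\<And>n. R (Suc n) = R n - step n (R n)"
      by (simp_all add: R_def)
    \<comment> \<open>Equality holds at \<open>n = 0\<close>. Later bounds need no induction
      hypothesis, since \<open>step\<close> leaves a residual below \<open>e (Suc n)\<close>
      whatever vector it starts from.\<close>
    have R: "norm (R n) \<le> e n" for n
      by (cases n) (use step(1) in \<open>simp_all add: R0 RS less_imp_le\<close>, simp add: e_def)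
    define y where "y n = L (step n (R n))" for n
    have y: "norm (y n) \<le> M * e n" for n
      using step(2)[of n "R n"] R[of n] M by (smt (verit) mult_left_mono y_def)
    have e_sums: "(\<lambda>n. M * e n) sums (M * (norm u * 2))"
      using sums_mult[OF geometric_sums[of "1/2::real"], of "M * norm u"]
      by (simp add: e_def power_one_over field_simps)
    have y_summable: "summable (\<lambda>n. norm (y n))"
      by (rule summable_comparison_test'[OF sums_summable[OF e_sums]]) (use y in simp)
    \<comment> \<open>The sum telescopes: \<open>u - R n\<close> is the sum of the approximants
      removed so far.\<close>
    have partial: "(\<Sum>k<n. y k) = L (u - R n)" for n
      by (induction n) (simp_all add: R0 RS y_def L.diff)
    have "e \<longlonglongrightarrow> 0"
      unfolding e_def using LIMSEQ_divide_realpow_zero[of 2 "norm u"] by simp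
    then have "R \<longlonglongrightarrow> 0"
      using R by (rule Lim_null_comparison[OF always_eventually, rule_format, rotated])
    then have 1: "(\<lambda>n. u - R n) \<longlonglongrightarrow> u"
      using tendsto_diff[OF tendsto_const] by fastforce
    have 2: "(\<lambda>n. L (u - R n)) \<longlonglongrightarrow> suminf y"
      using summable_LIMSEQ[OF summable_norm_cancel[OF y_summable]] by (simp add: partial)
    have "(u, suminf y) \<in> range (\<lambda>x. (x, L x))"
      by (rule closed_sequentially[OF closed _ tendsto_Pair[OF 1 2]]) simp
    then have "norm (L u) = norm (suminf y)" by auto
    also have "\<dots> \<le> (\<Sum>n. norm (y n))" by (rule summable_norm[OF y_summable])
    also have "\<dots> \<le> M * (norm u * 2)"
      using suminf_le[OF y y_summable sums_summable[OF e_sums]] sums_unique[OF e_sums] by simp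
    finally show ?thesis by (simp add: algebra_simps)
  qed
  then show ?thesis
    by (intro bounded_linear.intro bounded_linear_axioms.intro assms(1))
      (metis mult.commute)
qed

text \<open>The graph of \<open>B\<close> composed with \<iota> is the preimage of the closed graph
  of \<open>B\<close> under the continuous map \<open>(y, x)\<close> to
  \<open>(\<iota> y, x)\<close>, so the closed graph theorem applies on \<open>Y\<close>.\<close>

lemma closed_operator_bounded_on_subspace:
  fixes \<iota> :: "'y::complex_banach \<Rightarrow> 'x::complex_banach"
  assumes "closed_linear_operator D B" and "continuous_embedding \<iota>" and "range \<iota> \<subseteq> D"
  shows "bounded_linear (\<lambda>y. B (\<iota> y))"
proof (rule closed_graph_bounded_linear)
  interpret \<iota>: bounded_linear \<iota>
    using assms(2) by (simp add: continuous_embedding_def bounded_clinear_def)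
  have B: "linear_operator D B" and closed: "closed {(x, B x) |x. x \<in> D}"
    using assms(1) by (simp_all add: closed_linear_operator_def)
  show "linear (\<lambda>y. B (\<iota> y))"
  proof
    fix b :: 'y and b' and r :: real
    show "B (\<iota> (b + b')) = B (\<iota> b) + B (\<iota> b')"
      using B assms(3) unfolding linear_operator_def \<iota>.add by blast
    have "B (complex_of_real r *\<^sub>C \<iota> b) = complex_of_real r *\<^sub>C B (\<iota> b)"
      using B assms(3) unfolding linear_operator_def by blast
    then show "B (\<iota> (r *\<^sub>R b)) = r *\<^sub>R B (\<iota> b)"
      by (simp add: \<iota>.scaleR scaleC_of_real)
  qed
  have graph: "range (\<lambda>y. (y, B (\<iota> y))) = (\<lambda>(y, x). (\<iota> y, x)) -` {(x, B x) |x. x \<in> D}"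
    using assms(3) by auto
  have "continuous_on UNIV (\<lambda>(y, x::'x). (\<iota> y, x))"
    unfolding case_prod_beta
    by (intro continuous_intros \<iota>.continuous_on)
  then show "closed (range (\<lambda>y. (y, B (\<iota> y))))"
    unfolding graph by (rule closed_vimage[OF closed])
qed


section \<open>Groups and their generators\<close>

lemma has_vector_derivative_imp_quotient_limit:
  assumes "(F has_vector_derivative d) (at 0)"
  shows "((\<lambda>h. (F h - F 0) /\<^sub>R h) \<longlongrightarrow> d) (at 0)"
proof -
  have "((\<lambda>h. norm ((F h - F 0) - h *\<^sub>R d) / \<bar>h\<bar>) \<longlongrightarrow> 0) (at 0)"
    using assms unfolding has_vector_derivative_def has_derivative_at by simp
  moreover have "norm ((F h - F 0) - h *\<^sub>R d) / \<bar>h\<bar> = norm ((F h - F 0) /\<^sub>R h - d)"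
    if "h \<noteq> 0" for h
  proof -
    have "(F h - F 0) /\<^sub>R h - d = ((F h - F 0) - h *\<^sub>R d) /\<^sub>R h"
      using that by (simp add: algebra_simps)
    then show ?thesis by (simp add: divide_inverse mult.commute)
  qed
  ultimately have "((\<lambda>h. norm ((F h - F 0) /\<^sub>R h - d)) \<longlongrightarrow> 0) (at 0)"
    by (force elim: Lim_transform_eventually simp: eventually_at_filter)
  then show ?thesis
    by (simp add: tendsto_norm_zero_iff LIM_zero_iff)
qed

lemma integral_has_vector_derivative_at:
  fixes f :: "real \<Rightarrow> 'a::banach"
  assumes "continuous_on UNIV f" and "a < x"
  shows "((\<lambda>u. integral {a..u} f) has_vector_derivative f x) (at x)"
proof -
  \<comment> \<open>The endpoint \<open>x + 1\<close> puts \<open>x\<close> in the interior of the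
    interval, so the derivative within it is two-sided.\<close>
  have "((\<lambda>u. integral {a..u} f) has_vector_derivative f x) (at x within {a..x+1})"
    by (rule integral_has_vector_derivative)
      (use assms in \<open>auto intro: continuous_on_subset\<close>)
  then show ?thesis
    using assms(2) by (simp add: at_within_Icc_at)
qed

text \<open>By the group law, \<open>T h\<close> shifts the interval of integration by
  \<open>h\<close>. The difference quotient thus becomes that of an antiderivative of the orbit at
  the two endpoints.\<close>

lemma c0_group_integral_in_generator:
  fixes T :: "real \<Rightarrow> 'a::complex_banach \<Rightarrow> 'a"
  assumes "c0_group T" and "a \<le> b"
  shows "((\<lambda>h. (T h (integral {a..b} (\<lambda>r. T r z)) - integral {a..b} (\<lambda>r. T r z)) /\<^sub>R h)
           \<longlongrightarrow> T b z - T a z) (at 0)"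
proof -
  let ?f = "\<lambda>r. T r z"
  have cont: "continuous_on UNIV ?f" and lin: "\<And>h. bounded_linear (T h)"
    and add: "\<And>t s. T (t + s) = T t \<circ> T s"
    using assms(1) by (auto simp: c0_group_def bounded_clinear_def)
  have int: "?f integrable_on {c..d}" for c d
    by (intro integrable_continuous_real continuous_on_subset[OF cont]) simp
  \<comment> \<open>Starting at \<open>a - 1\<close> makes \<open>a\<close> an interior point and
    leaves room for negative shifts \<open>h\<close> above -1.\<close>
  define \<Phi> where "\<Phi> u = integral {a-1..u} ?f" for u
  define F where "F h = \<Phi> (h + b) - \<Phi> (h + a)" for h
  have "(\<Phi> has_vector_derivative ?f u) (at u)" if "a - 1 < u" for u
    unfolding \<Phi>_def by (rule integral_has_vector_derivative_at[OF cont that])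
  moreover have "((\<lambda>h. h + c) has_vector_derivative 1) (at 0)" for c :: real
    by (auto simp flip: has_real_derivative_iff_has_vector_derivative intro!: derivative_eq_intros)
  ultimately have "((\<lambda>h. \<Phi> (h + c)) has_vector_derivative ?f c) (at 0)" if "a \<le> c" for c
    using that vector_diff_chain_at[of "\<lambda>h. h + c" 1 0 \<Phi> "?f c"] by (simp add: o_def)
  then have "(F has_vector_derivative ?f b - ?f a) (at 0)"
    unfolding F_def using assms(2) by (intro has_vector_derivative_diff) auto
  then have lim: "((\<lambda>h. (F h - F 0) /\<^sub>R h) \<longlongrightarrow> ?f b - ?f a) (at 0)"
    by (rule has_vector_derivative_imp_quotient_limit)
  have F: "F h = T h (integral {a..b} ?f)" if "\<bar>h\<bar> < 1" for h
  proof -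
    have "integral {a-1..h+a} ?f + integral {h+a..h+b} ?f = integral {a-1..h+b} ?f"
      using that assms(2) int by (intro Henstock_Kurzweil_Integration.integral_combine) auto
    then have "F h = integral {a+h..b+h} ?f"
      by (simp add: F_def \<Phi>_def algebra_simps)
    also have "\<dots> = integral {a..b} (T h \<circ> ?f)"
      unfolding integral_shift_Icc_real[symmetric] by (simp add: o_def add)
    also have "\<dots> = T h (integral {a..b} ?f)"
      by (rule integral_linear[OF int lin])
    finally show ?thesis .
  qed
  have "F 0 = integral {a..b} ?f"
    using F[of 0] assms(1) by (simp add: c0_group_def)
  moreover have "\<forall>\<^sub>F h in at (0::real). \<bar>h\<bar> < 1"
    unfolding eventually_at by (intro exI[of _ 1]) (simp add: dist_real_def)
  ultimately show ?thesis
    using F by (intro Lim_transform_eventually[OF lim]) (auto elim: eventually_mono)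
qed

lemma generator_integral:
  fixes T :: "real \<Rightarrow> 'a::complex_banach \<Rightarrow> 'a"
  assumes "generates_c0_group D G T" and "a \<le> b"
  shows "integral {a..b} (\<lambda>r. T r z) \<in> D" "G (integral {a..b} (\<lambda>r. T r z)) = T b z - T a z"
proof -
  have "c0_group T" using assms(1) by (simp add: generates_c0_group_def)
  note lim = c0_group_integral_in_generator[OF this assms(2), of z]
  show D: "integral {a..b} (\<lambda>r. T r z) \<in> D"
    using lim assms(1) by (auto simp: generates_c0_group_def)
  show "G (integral {a..b} (\<lambda>r. T r z)) = T b z - T a z"
    using D assms(1) tendsto_unique[OF _ _ lim] by (auto simp: generates_c0_group_def)
qed

text \<open>Since \<open>T h\<close> commutes with \<open>T t\<close>, the difference quotient at
  \<open>T t w\<close> is the image under \<open>T t\<close> of the one at \<open>w\<close>, and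
  \<open>T t\<close> is continuous.\<close>

lemma generator_commutes:
  fixes T :: "real \<Rightarrow> 'a::complex_banach \<Rightarrow> 'a"
  assumes "generates_c0_group D G T" and "w \<in> D"
  shows "T t w \<in> D" "G (T t w) = T t (G w)"
proof -
  have T: "c0_group T" using assms(1) by (simp add: generates_c0_group_def)
  interpret T: bounded_linear "T t" using T by (simp add: c0_group_def bounded_clinear_def)
  have "T h (T t w) = T t (T h w)" for h
    using T unfolding c0_group_def by (metis add.commute comp_apply)
  moreover have "((\<lambda>h. T t ((T h w - w) /\<^sub>R h)) \<longlongrightarrow> T t (G w)) (at 0)"
    using assms by (intro T.tendsto) (simp add: generates_c0_group_def)
  ultimately have lim: "((\<lambda>h. (T h (T t w) - T t w) /\<^sub>R h) \<longlongrightarrow> T t (G w)) (at 0)"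
    by (simp add: T.scaleR T.diff)
  show D: "T t w \<in> D"
    using lim assms(1) by (auto simp: generates_c0_group_def)
  show "G (T t w) = T t (G w)"
    using D assms(1) tendsto_unique[OF _ _ lim] by (auto simp: generates_c0_group_def)
qed


section \<open>The operator matrix\<close>

text \<open>On the matrix domain both \<open>B (\<iota> y)\<close> and the second component lie in
  the range of \<iota>, so \<open>inv \<iota>\<close> is applied only where \<iota> undoes
  it.\<close>

lemma fst_matrix_op:
  fixes \<iota> :: "'y::complex_banach \<Rightarrow> 'x::complex_banach"
  assumes "linear \<iota>" and "B ` domA \<subseteq> range \<iota>" and "w \<in> matrix_dom \<iota> domA"
  shows "\<iota> (fst (matrix_op \<iota> A B w)) = snd w - B (\<iota> (fst w))"
proof -
  obtain y x where w: "w = (y, \<iota> x)" "\<iota> y \<in> domA"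
    using assms(3) by (auto simp: matrix_dom_def)
  then obtain v where v: "B (\<iota> y) = \<iota> v" using assms(2) by blast
  have "- B (\<iota> y) + \<iota> x = \<iota> (x - v)"
    using v by (simp add: linear_diff[OF assms(1)])
  then have "\<iota> (inv \<iota> (- B (\<iota> y) + \<iota> x)) = - B (\<iota> y) + \<iota> x"
    by (metis f_inv_into_f rangeI)
  then show ?thesis by (simp add: w matrix_op_def)
qed

text \<open>Integrating the first row of the Cauchy problem and using boundedness of \<open>B\<close> on \<open>Y\<close>
  gives the derivative for every initial value, not only for those in the generator domain.\<close>

lemma first_component_has_derivative:
  fixes \<iota> :: "'y::complex_banach \<Rightarrow> 'x::complex_banach"
  assumes "bounded_linear \<iota>" and "bounded_linear (\<lambda>y. B (\<iota> y))" and "B ` domA \<subseteq> range \<iota>"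
    and gen: "generates_c0_group (matrix_dom \<iota> domA) (matrix_op \<iota> A B) T"
  shows "((\<lambda>r. \<iota> (fst (T r z))) has_vector_derivative snd (T s z) - B (\<iota> (fst (T s z)))) (at s)"
proof -
  interpret \<iota>: bounded_linear \<iota> by fact
  define L where "L y = B (\<iota> y)" for y
  have L: "bounded_linear L" unfolding L_def by fact
  \<comment> \<open>Any base point below \<open>s\<close> would do: the integral formula holds for
    all \<open>u\<close> above it, hence on a neighbourhood of \<open>s\<close>.\<close>
  let ?a = "s - 1"
  define K :: "'y \<times> 'x \<Rightarrow> 'x" where "K w = snd w - L (fst w)" for w
  have K: "bounded_linear K"
    unfolding K_def
    by (intro bounded_linear_sub bounded_linear_snd bounded_linear_compose[OF L bounded_linear_fst])
  have cont: "continuous_on UNIV (\<lambda>r. T r z)"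
    using gen unfolding generates_c0_group_def c0_group_def by blast
  have der: "((\<lambda>u. \<iota> (fst (T ?a z)) + K (integral {?a..u} (\<lambda>r. T r z)))
          has_vector_derivative 0 + K (T s z)) (at s)"
    by (intro has_vector_derivative_add has_vector_derivative_const
        bounded_linear.has_vector_derivative[OF K] integral_has_vector_derivative_at[OF cont]) simp
  \<comment> \<open>The integral lies in the generator domain even if \<open>z\<close> does not. Its
    image is \<open>T u z - T ?a z\<close>, and \<open>K\<close> is the first row of the matrix read
    in \<open>X\<close>.\<close>
  have eq: "\<iota> (fst (T ?a z)) + K (integral {?a..u} (\<lambda>r. T r z)) = \<iota> (fst (T u z))"
    if "u \<in> {?a<..}" for u
  proof -
    have "?a \<le> u" using that by simp
    note int = generator_integral[OF gen this, of z]
    show ?thesis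
      using fst_matrix_op[OF \<iota>.linear_axioms assms(3) int(1), of A] unfolding int(2)
      by (simp add: K_def L_def \<iota>.diff algebra_simps)
  qed
  have "((\<lambda>u. \<iota> (fst (T u z))) has_vector_derivative 0 + K (T s z)) (at s)"
    by (rule has_vector_derivative_transform_within_open[OF der open_greaterThan _ eq]) auto
  then show ?thesis by (simp add: K_def L_def)
qed

text \<open>The first row of \<open>T t G = G T t\<close> at \<open>(0, y)\<close> rewrites \<open>T\<^sub>2\<^sub>2 - B T\<^sub>1\<^sub>2\<close> as
  \<open>T\<^sub>1\<^sub>1 - T\<^sub>1\<^sub>2 B\<close> on \<open>Y\<close>.\<close>

lemma cosine_family_eq_first_component:
  fixes \<iota> :: "'y::complex_banach \<Rightarrow> 'x::complex_banach"
  assumes "linear \<iota>" and "linear_operator domA A" and "linear_operator domB B"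
    and "B ` domA \<subseteq> range \<iota>" and "inj \<iota>"
    and gen: "generates_c0_group (matrix_dom \<iota> domA) (matrix_op \<iota> A B) T"
  shows "cosine_family \<iota> B T t (\<iota> y) = \<iota> (fst (T t (y, B (\<iota> y))))"
proof -
  interpret \<iota>: linear \<iota> by fact
  interpret T: bounded_linear "T t"
    using gen by (simp add: generates_c0_group_def c0_group_def bounded_clinear_def)
  have zero: "F 0 = 0" "0 \<in> D" if "linear_operator D F" for D :: "'x set" and F
  proof -
    show "0 \<in> D" using that by (simp add: linear_operator_def)
    then have "F (0 + 0) = F 0 + F 0" using that by (simp only: linear_operator_def)
    then show "F 0 = 0" by simp
  qed
  let ?w = "(0, \<iota> y)"
  have w: "?w \<in> matrix_dom \<iota> domA"
    using zero[OF assms(2)] by (simp add: matrix_dom_def)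
  have "matrix_op \<iota> A B ?w = (y, - B (\<iota> y))"
    using zero[OF assms(2)] zero[OF assms(3)] assms(5) by (simp add: matrix_op_def)
  then have "snd (T t ?w) - B (\<iota> (fst (T t ?w))) = \<iota> (fst (T t (y, - B (\<iota> y))))"
    using fst_matrix_op[OF assms(1,4) generator_commutes(1)[OF gen w], of A t]
      generator_commutes(2)[OF gen w, of t] by simp
  \<comment> \<open>The term with factor 2 in the cosine family turns \<open>- B (\<iota> y)\<close>
    in the second component into \<open>B (\<iota> y)\<close>.\<close>
  moreover have "T t (y, B (\<iota> y)) = T t (y, - B (\<iota> y)) + 2 *\<^sub>R T t (0, B (\<iota> y))"
    by (simp add: T.add[symmetric] T.scaleR[symmetric] scaleR_2)
  ultimately show ?thesis
    by (simp add: cosine_family_def block12_def block22_def \<iota>.add \<iota>.scale)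
qed

theorem lemma5p7:
  fixes domA domB :: "'x::complex_banach set"
    and A B :: "'x \<Rightarrow> 'x"
    and \<iota> :: "'y::complex_banach \<Rightarrow> 'x"
    and T :: "real \<Rightarrow> 'y \<times> 'x \<Rightarrow> 'y \<times> 'x"
  assumes "closed_linear_operator domA A"
    and "closed_linear_operator domB B"
    and "resolvent_set domB B \<noteq> {}"
    and "continuous_embedding \<iota>"
    and "domA \<subseteq> {x \<in> domB. B x \<in> domB} \<inter> range \<iota>"
    and "B ` domA \<subseteq> range \<iota>"
    and "range \<iota> \<subseteq> domB"
    and "generates_c0_group (matrix_dom \<iota> domA) (matrix_op \<iota> A B) T"
  shows "\<forall>t s.
    (\<forall>x. sine_family \<iota> T (t + s) x =
       cosine_family \<iota> B T t (sine_family \<iota> T s x) +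
       sine_family \<iota> T t (strong_deriv (sine_family \<iota> T) s x)) \<and>
    (\<forall>y\<in>range \<iota>. cosine_family \<iota> B T (t + s) y =
       cosine_family \<iota> B T t (cosine_family \<iota> B T s y) +
       sine_family \<iota> T t (strong_deriv (cosine_family \<iota> B T) s y))"
proof -
  have \<iota>: "bounded_linear \<iota>" "inj \<iota>"
    using assms(4) by (simp_all add: continuous_embedding_def bounded_clinear_def)
  interpret \<iota>: bounded_linear \<iota> by (rule \<iota>)
  have ops: "linear_operator domA A" "linear_operator domB B"
    using assms(1,2) by (simp_all add: closed_linear_operator_def)
  have group: "c0_group T" using assms(8) by (simp add: generates_c0_group_def)
  note cosine = cosine_family_eq_first_component[OF \<iota>.linear_axioms ops assms(6) \<iota>(2) assms(8)]
  note bounded = closed_operator_bounded_on_subspace[OF assms(2,4,7)]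
  have deriv: "vector_derivative (\<lambda>r. \<iota> (fst (T r z))) (at s)
      = snd (T s z) - B (\<iota> (fst (T s z)))" for s z
    by (intro vector_derivative_at first_component_has_derivative[OF \<iota>(1) bounded assms(6,8)])
  have step: "\<iota> (fst (T (t + s) z)) = cosine_family \<iota> B T t (\<iota> (fst (T s z)))
      + sine_family \<iota> T t (snd (T s z) - B (\<iota> (fst (T s z))))" for t s z
  proof -
    interpret T: bounded_linear "T t"
      using group by (simp add: c0_group_def bounded_clinear_def)
    obtain u v where uv: "T s z = (u, v)" by fastforce
    have "T (t + s) z = T t (u, v)" using group uv by (simp add: c0_group_def)
    \<comment> \<open>The first summand has the form whose first component is a cosine value; the
      second yields a sine value at the derivative computed in \<open>deriv\<close>.\<close>
    also have "\<dots> = T t (u, B (\<iota> u)) + T t (0, v - B (\<iota> u))"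
      by (simp add: T.add[symmetric])
    finally show ?thesis
      by (simp add: uv cosine sine_family_def block12_def \<iota>.add)
  qed
  have sine: "sine_family \<iota> T t x = \<iota> (fst (T t (0, x)))" for t x
    by (simp add: sine_family_def block12_def)
  show ?thesis
  proof (intro allI conjI ballI)
    fix t s x
    show "sine_family \<iota> T (t + s) x = cosine_family \<iota> B T t (sine_family \<iota> T s x)
        + sine_family \<iota> T t (strong_deriv (sine_family \<iota> T) s x)"
      using step[of t s "(0, x)"] deriv[of "(0, x)" s] by (simp only: sine strong_deriv_def)
  next
    fix t s y
    assume "y \<in> range \<iota>"
    then obtain u where "y = \<iota> u" by blast
    then show "cosine_family \<iota> B T (t + s) y = cosine_family \<iota> B T t (cosine_family \<iota> B T s y)
        + sine_family \<iota> T t (strong_deriv (cosine_family \<iota> B T) s y)"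
      \<comment> \<open>For this initial value the orbit's first component is the cosine family at
        \<open>\<iota> u\<close>. It stays in the range of \<iota>, so \<open>cosine\<close> also
        rewrites the nested application.\<close>
      using step[of t s "(u, B (\<iota> u))"] deriv[of "(u, B (\<iota> u))" s]
      by (simp only: cosine strong_deriv_def)
  qed
qed

end
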